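(* Assume $T=\bigcup_{k=1}^L T_k\subseteq\mathbb{R}^n$ is a compact semialgebraic set with $$T_k=\{x\in\mathbb{R}^n:\ f^k_1(x)\ge 0,\dots,f^k_{m_k}(x)\ge 0\}$$ defined by polynomials $f^k_i$, and assume that its convex hull $\mathrm{conv}(T)$ is SDP representable. For each $k$, each $u\in\partial_cT\cap\partial T_k$ and each $i\in I_k(u)$, if $f^k_i$ is nonsingular at $u$ and irredundant at $u$ with respect to $\partial\,\mathrm{conv}(T)$, then $f^k_i$ is quasi-concave at $u$.
   Context: For a set $T\subseteq\mathbb{R}^n$, the convex boundary is $\partial_cT=\{u\in T:\ \ell^Tu=\min_{x\in T}\ell^Tx\text{ for some }\ell\in\mathbb{R}^n\text{ with }\|\ell\|=1\}$. $\partial$ denotes topological boundary. A set $S\subseteq\mathbb{R}^n$ is SDP representable if there are $N\ge 0$ and real symmetric matrices $A_0,A_1,\dots,A_n,B_1,\dots,B_N$ of a common size such that $S=\{x\in\mathbb{R}^n:\exists u\in\mathbb{R}^N,\ A_0+\sum_{i=1}^n x_iA_i+\sum_{j=1}^N u_jB_j\succeq 0\}$, where $\succeq 0$ means positive semidefinite. For $u\in\partial T_k$, $I_k(u)=\{1\le i\le m_k: f^k_i(u)=0\}$. The point $u$ is a nonsingular point on $\partial T_k$ if $|I_k(u)|=1$ and $\nabla f^k_i(u)\ne 0$ for $i\in I_k(u)$. The polynomial $f^k_i$ is irredundant at $u$ with respect to $\partial\,\mathrm{conv}(T)$ if there is a sequence of nonsingular points $u_N$ on $\partial T_k$ with $u_N\in\{x:f^k_i(x)=0\}\cap\partial\,\mathrm{conv}(T)$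 and $u_N\to u$. It is nonsingular at $u$ if $\nabla f^k_i(u)\ne 0$. A smooth function $f$ is quasi-concave at $u$ if $-v^T\nabla^2 f(u)v\ge 0$ for all $v\in\mathbb{R}^n$ with $\nabla f(u)^Tv=0$. *)

theory Defs
  imports "HOL-Analysis.Analysis"
begin

section \<open>Gradient, Hessian, quasi-concavity\<close>

definition gradient :: "(real^'n \<Rightarrow> real) \<Rightarrow> real^'n \<Rightarrow> real^'n" where
  "gradient f u = (THE D. GDERIV f u :> D)"

definition hessian :: "(real^'n \<Rightarrow> real) \<Rightarrow> real^'n \<Rightarrow> real^'n^'n" where
  "hessian f u = jacobian (gradient f) (at u)"

definition nonsingular_at :: "(real^'n \<Rightarrow> real) \<Rightarrow> real^'n \<Rightarrow> bool" where
  "nonsingular_at f u \<longleftrightarrow> gradient f u \<noteq> 0"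

definition quasi_concave_at :: "(real^'n \<Rightarrow> real) \<Rightarrow> real^'n \<Rightarrow> bool" where
  "quasi_concave_at f u \<longleftrightarrow>
    (\<forall>v. gradient f u \<bullet> v = 0 \<longrightarrow> - (v \<bullet> (hessian f u *v v)) \<ge> 0)"

section \<open>Convex boundary\<close>

definition convex_boundary :: "(real^'n) set \<Rightarrow> (real^'n) set" where
  "convex_boundary T = {u \<in> T. \<exists>l. norm l = 1 \<and> (\<forall>x\<in>T. l \<bullet> u \<le> l \<bullet> x)}"

section \<open>SDP representable sets\<close>

text \<open>
  The matrix size and the number of lifting variables are existentially quantified numbers, so
  a \<open>d \<times> d\<close> matrix is a function on pairs of indices of which only the values at indices
  below \<open>d\<close> matter. Likewise, only the values \<open>w j\<close> and \<open>B j\<close> for \<open>j < N\<close> matter.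
\<close>

definition symmetric_matrix :: "nat \<Rightarrow> (nat \<Rightarrow> nat \<Rightarrow> real) \<Rightarrow> bool" where
  "symmetric_matrix d M \<longleftrightarrow> (\<forall>r<d. \<forall>c<d. M r c = M c r)"

definition psd_matrix :: "nat \<Rightarrow> (nat \<Rightarrow> nat \<Rightarrow> real) \<Rightarrow> bool" where
  "psd_matrix d M \<longleftrightarrow>
    symmetric_matrix d M \<and> (\<forall>z::nat \<Rightarrow> real. (\<Sum>r<d. \<Sum>c<d. z r * M r c * z c) \<ge> 0)"

definition sdp_representable :: "(real^'n) set \<Rightarrow> bool" where
  "sdp_representable S \<longleftrightarrow>
    (\<exists>(N::nat) (d::nat) (A\<^sub>0 :: nat \<Rightarrow> nat \<Rightarrow> real)
       (A :: 'n \<Rightarrow> nat \<Rightarrow> nat \<Rightarrow> real) (B :: nat \<Rightarrow> nat \<Rightarrow> nat \<Rightarrow> real).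
       symmetric_matrix d A\<^sub>0 \<and> (\<forall>i. symmetric_matrix d (A i)) \<and>
       (\<forall>j<N. symmetric_matrix d (B j)) \<and>
       S = {x. \<exists>w::nat \<Rightarrow> real. psd_matrix d
              (\<lambda>r c. A\<^sub>0 r c + (\<Sum>i\<in>UNIV. x $ i * A i r c) + (\<Sum>j<N. w j * B j r c))})"

section \<open>Basic closed semialgebraic sets\<close>

text \<open>
  In the following definitions \<open>g 1, \<dots>, g m\<close> are the defining functions of the set
  \<open>basic_closed m g\<close>; the values of \<open>g\<close> at other indices are irrelevant.
\<close>

definition basic_closed :: "nat \<Rightarrow> (nat \<Rightarrow> real^'n \<Rightarrow> real) \<Rightarrow> (real^'n) set" where
  "basic_closed m g = {x. \<forall>i\<in>{1..m}. g i x \<ge> 0}"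

definition active_set :: "nat \<Rightarrow> (nat \<Rightarrow> real^'n \<Rightarrow> real) \<Rightarrow> real^'n \<Rightarrow> nat set" where
  "active_set m g u = {i \<in> {1..m}. g i u = 0}"

definition nonsingular_boundary_point ::
    "nat \<Rightarrow> (nat \<Rightarrow> real^'n \<Rightarrow> real) \<Rightarrow> real^'n \<Rightarrow> bool" where
  "nonsingular_boundary_point m g u \<longleftrightarrow>
    u \<in> frontier (basic_closed m g) \<and> card (active_set m g u) = 1 \<and>
    (\<forall>i \<in> active_set m g u. gradient (g i) u \<noteq> 0)"

definition irredundant_at ::
    "(real^'n) set \<Rightarrow> nat \<Rightarrow> (nat \<Rightarrow> real^'n \<Rightarrow> real) \<Rightarrow> nat \<Rightarrow> real^'n \<Rightarrow> bool" where
  "irredundant_at T m g i u \<longleftrightarrow>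
    (\<exists>U::nat \<Rightarrow> real^'n.
       (\<forall>N. nonsingular_boundary_point m g (U N) \<and>
            U N \<in> {x. g i x = 0} \<inter> frontier (convex hull T)) \<and>
       U \<longlonglongrightarrow> u)"

end

theory Submission
  imports Defs
begin

text \<open>
  Let \<open>f\<close> be one of the defining polynomials. At a nonsingular point \<open>p\<close> the set \<open>T\<^sub>k\<close> is locally
  \<open>{f \<ge> 0}\<close>. If moreover \<open>p\<close> lies on the boundary of the convex hull of \<open>T\<close>, a supporting functional
  \<open>l\<close> at \<open>p\<close> is a positive multiple of \<open>\<nabla>f(p)\<close>. If \<open>v\<close> were a tangent vector with
  \<open>v\<^sup>T\<nabla>\<^sup>2f(p)v > 0\<close>, then the curve \<open>p + t v - s t\<^sup>2 \<nabla>f(p)\<close> with a small \<open>s > 0\<close> would stay in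
  \<open>{f > 0}\<close> for small \<open>t > 0\<close> although \<open>l\<close> decreases along it. So \<open>f\<close> is quasi-concave at every such
  point, and irredundancy carries this over to \<open>u\<close> by continuity of \<open>\<nabla>f\<close> and \<open>\<nabla>\<^sup>2f\<close>.
\<close>

section \<open>Gradient and Hessian of a polynomial\<close>

text \<open>Keeping the gradient polynomial lets the lemma be applied again to its components, which
  yields the Hessian and the continuity of both.\<close>

lemma real_polynomial_function_gradient:
  fixes f :: "'a::euclidean_space \<Rightarrow> real"
  assumes "real_polynomial_function f"
  shows "\<exists>G. polynomial_function G \<and> (\<forall>x. GDERIV f x :> G x)"
  using assms
proof (induction rule: real_polynomial_function.induct)
  case (linear f)
  \<comment> \<open>\<open>adjoint f 1\<close> is the Riesz vector representing the functional
    \<open>f\<close>.\<close>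
  have "h \<bullet> adjoint f 1 = f h" for h
    using adjoint_works[OF bounded_linear.linear[OF linear], of h 1] by simp
  then have "GDERIV f x :> adjoint f 1" for x
    using bounded_linear_imp_has_derivative[OF linear] by (simp add: gderiv_def)
  then show ?case
    by (intro exI[of _ "\<lambda>_. adjoint f 1"]) simp
next
  case (const c)
  show ?case
    by (intro exI[of _ "\<lambda>_. 0"]) (simp add: GDERIV_const)
next
  case (add f g)
  then obtain F G where "polynomial_function F" "\<forall>x. GDERIV f x :> F x"
    "polynomial_function G" "\<forall>x. GDERIV g x :> G x"
    by blast
  then show ?case
    by (intro exI[of _ "\<lambda>x. F x + G x"] conjI allI polynomial_function_add GDERIV_add) auto
next
  case (mult f g)
  then obtain F G where "polynomial_function F" "\<forall>x. GDERIV f x :> F x"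
    "polynomial_function G" "\<forall>x. GDERIV g x :> G x"
    by blast
  with mult.hyps show ?case
    by (intro exI[of _ "\<lambda>x. f x *\<^sub>R G x + g x *\<^sub>R F x"] conjI allI GDERIV_mult
        polynomial_function_add polynomial_function_mult)
      (simp_all add: real_polynomial_function_eq)
qed

lemma gradient_eqI:
  assumes "GDERIV f x :> D"
  shows "gradient f x = D"
  unfolding gradient_def
proof (rule the_equality, rule assms)
  fix E assume "GDERIV f x :> E"
  then have "(\<lambda>h. h \<bullet> E) = (\<lambda>h. h \<bullet> D)"
    using assms unfolding gderiv_def by (rule has_derivative_unique)
  then show "E = D"
    by (metis vector_eq_ldot)
qed

lemma real_polynomial_function_gradient_hessian:
  fixes f :: "real^'n \<Rightarrow> real"
  assumes "real_polynomial_function f"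
  shows "GDERIV f x :> gradient f x"
    and "(gradient f has_derivative (\<lambda>h. hessian f x *v h)) (at x)"
    and "continuous_on UNIV (gradient f)"
    and "continuous_on UNIV (hessian f)"
proof -
  obtain G where G: "polynomial_function G" "\<And>x. GDERIV f x :> G x"
    using real_polynomial_function_gradient[OF assms] by blast
  have grad: "gradient f = G"
    using G(2) gradient_eqI by blast
  show "GDERIV f x :> gradient f x"
    using G(2) grad by simp
  show cont: "continuous_on UNIV (gradient f)"
    using G(1) grad continuous_on_polymonial_function by blast
  have "real_polynomial_function (\<lambda>x. G x $ j)" for j
    using G(1) bounded_linear_vec_nth[of j] by (auto simp: polynomial_function_def o_def)
  then have "\<exists>K. polynomial_function K \<and> (\<forall>x. GDERIV (\<lambda>x. G x $ j) x :> K x)" for j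
    using real_polynomial_function_gradient by blast
  then obtain K where K: "\<And>j. polynomial_function (K j)" "\<And>j x. GDERIV (\<lambda>x. G x $ j) x :> K j x"
    by metis
  \<comment> \<open>The rows of the Jacobian of \<open>G\<close> are the gradients of its
    components.\<close>
  define M where "M x = (\<chi> j. K j x)" for x
  have M: "(G has_derivative (\<lambda>h. M x *v h)) (at x)" for x
  proof (subst has_derivative_componentwise_within, intro ballI)
    fix b :: "real^'n" assume "b \<in> Basis"
    then obtain j where "b = axis j 1"
      by (auto simp: Basis_vec_def)
    moreover have "(M x *v h) \<bullet> axis j 1 = h \<bullet> K j x" for h
      by (simp add: inner_axis M_def matrix_vector_mul_component inner_commute[of h])
    ultimately show "((\<lambda>x. G x \<bullet> b) has_derivative (\<lambda>h. (M x *v h) \<bullet> b)) (at x)"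
      using K(2)[of j x] by (simp add: gderiv_def inner_axis)
  qed
  have hess: "hessian f = M"
  proof
    fix x
    have "frechet_derivative G (at x) = (\<lambda>h. M x *v h)"
      using frechet_derivative_at[OF M[of x]] by simp
    then show "hessian f x = M x"
      by (simp add: hessian_def jacobian_def grad)
  qed
  show "(gradient f has_derivative (\<lambda>h. hessian f x *v h)) (at x)"
    using M grad hess by simp
  show "continuous_on UNIV (hessian f)"
    unfolding hess M_def
    using K(1) continuous_on_polymonial_function by (intro continuous_on_vec_lambda) blast
qed

section \<open>Supporting functionals and growth along curves\<close>

text \<open>If \<open>S\<close> has empty interior, a frontier point may lie in the relative
  interior; then \<open>S\<close> lies in a hyperplane, whose normal supports \<open>S\<close>
  trivially. Otherwise frontier and relative frontier agree.\<close>

lemma supporting_hyperplane_frontier: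
  fixes S :: "'a::euclidean_space set"
  assumes "convex S" "x \<in> frontier S"
  obtains a where "a \<noteq> 0" "\<And>y. y \<in> S \<Longrightarrow> a \<bullet> x \<le> a \<bullet> y"
proof (cases "interior S = {}")
  case True
  then obtain a b where a: "a \<noteq> 0" "S \<subseteq> {x. a \<bullet> x = b}"
    using empty_interior_subset_hyperplane[OF assms(1)] by blast
  then have "closure S \<subseteq> {x. a \<bullet> x = b}"
    by (simp add: closure_minimal closed_hyperplane)
  then have "a \<bullet> x = b"
    using assms(2) by (auto simp: frontier_def)
  then have "a \<bullet> x \<le> a \<bullet> y" if "y \<in> S" for y
    using a(2) that by auto
  then show ?thesis
    by (rule that[OF a(1)])
next
  case False
  then have "x \<notin> rel_interior S" "x \<in> closure S"
    using assms(2) by (auto simp: frontier_def rel_interior_nonempty_interior)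
  then obtain a where "a \<noteq> 0" "\<And>y. y \<in> closure S \<Longrightarrow> a \<bullet> x \<le> a \<bullet> y"
    using supporting_hyperplane_relative_frontier[OF assms(1)] by metis
  then show ?thesis
    using that closure_subset by (meson subsetD)
qed

text \<open>Along the parabola, \<open>f\<close> has first derivative 0 at \<open>t = 0\<close>, and
  its second derivative there is the quantity assumed positive in \<open>pos\<close>.\<close>

lemma second_order_increase:
  fixes f :: "real^'n \<Rightarrow> real"
  assumes f: "\<And>x. GDERIV f x :> G x"
    and G: "(G has_derivative (\<lambda>h. H *v h)) (at p)"
    and v: "G p \<bullet> v = 0"
    and pos: "v \<bullet> (H *v v) + 2 * (G p \<bullet> w) > 0"
  shows "eventually (\<lambda>t. f (p + t *\<^sub>R v + t\<^sup>2 *\<^sub>R w) > f p) (at_right 0)"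
proof -
  define c where "c t = p + t *\<^sub>R v + t\<^sup>2 *\<^sub>R w" for t :: real
  define d where "d t = G (c t) \<bullet> (v + (2 * t) *\<^sub>R w)" for t :: real
  have c: "(c has_derivative (\<lambda>h. h *\<^sub>R (v + (2 * t) *\<^sub>R w))) (at t)" for t
    unfolding c_def
    by (auto intro!: derivative_eq_intros simp: algebra_simps)
  have fc: "((\<lambda>t. f (c t)) has_real_derivative d t) (at t)" for t
    using has_derivative_compose[OF c f[unfolded gderiv_def]]
    by (simp add: has_field_derivative_def d_def inner_commute mult.commute[of _ "_ \<bullet> _"])
  have c0: "c 0 = p"
    by (simp add: c_def)
  have "((\<lambda>t. G (c t)) has_derivative (\<lambda>h. H *v (h *\<^sub>R v))) (at 0)"
    using has_derivative_compose[OF c[of 0], of G "\<lambda>h. H *v h"] G c0 by simp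
  then have "(d has_derivative (\<lambda>h. G (c 0) \<bullet> (2 * h) *\<^sub>R w + (H *v (h *\<^sub>R v)) \<bullet> v)) (at 0)"
    unfolding d_def by (auto intro!: derivative_eq_intros)
  then have "(d has_real_derivative (v \<bullet> (H *v v) + 2 * (G p \<bullet> w))) (at 0)"
    by (rule has_derivative_imp_has_field_derivative)
      (simp add: c0 matrix_vector_mult_scaleR inner_commute algebra_simps)
  \<comment> \<open>\<open>G\<close> is differentiable only at \<open>p\<close>, so instead of a
    Taylor expansion the sign of \<open>d\<close> just right of 0 is used: it makes \<open>f\<close>
    increase along the curve.\<close>
  then obtain e where e: "e > 0" "\<And>h. 0 < h \<Longrightarrow> h < e \<Longrightarrow> d 0 < d h"
    using DERIV_pos_inc_right[OF _ pos, of d 0] by auto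
  have "d 0 = 0"
    using v by (simp add: d_def c0)
  have "f p < f (c t)" if "0 < t" "t < e" for t
  proof -
    have "f (c 0) < f (c t)"
    proof (rule DERIV_pos_imp_increasing_open[OF \<open>0 < t\<close>])
      show "\<exists>y. ((\<lambda>t. f (c t)) has_real_derivative y) (at x) \<and> y > 0" if "0 < x" "x < t" for x
        using fc[of x] e(2)[of x] that \<open>t < e\<close> \<open>d 0 = 0\<close> by auto
      show "continuous_on {0..t} (\<lambda>t. f (c t))"
        using fc by (intro DERIV_continuous_on) (blast intro: has_field_derivative_at_within)
    qed
    then show ?thesis by (simp add: c0)
  qed
  then show ?thesis
    unfolding c_def eventually_at_right_field using e(1) by blast
qed

lemma first_order_increase:
  fixes f :: "'a::real_inner \<Rightarrow> real"
  assumes "GDERIV f p :> g" "g \<bullet> h > 0"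
  shows "eventually (\<lambda>t. f (p + t *\<^sub>R h) > f p) (at_right 0)"
proof -
  have "((\<lambda>t. p + t *\<^sub>R h) has_derivative (\<lambda>t. t *\<^sub>R h)) (at 0)"
    by (auto intro!: derivative_eq_intros)
  from has_derivative_compose[OF this, of f "\<lambda>h. h \<bullet> g"] assms(1)
  have "((\<lambda>t. f (p + t *\<^sub>R h)) has_real_derivative (g \<bullet> h)) (at 0)"
    by (simp add: gderiv_def has_field_derivative_def inner_commute mult.commute[of _ "_ \<bullet> _"])
  from DERIV_pos_inc_right[OF this assms(2)] show ?thesis
    unfolding eventually_at_right_field by auto
qed

section \<open>Optimality conditions for a linear functional\<close>

text \<open>A Farkas argument with one constraint: \<open>l\<close> is nonnegative on the open
  half-space of directions in which \<open>f\<close> increases, hence on its closure, which forces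
  \<open>l\<close> to be a multiple of \<open>g\<close>.\<close>

lemma local_minimizer_multiplier:
  fixes f :: "'a::real_inner \<Rightarrow> real"
  assumes f: "GDERIV f p :> g"
    and l: "l \<noteq> 0" "\<forall>\<^sub>F x in nhds p. f x > f p \<longrightarrow> l \<bullet> p \<le> l \<bullet> x"
    and g: "g \<noteq> 0"
  shows "\<exists>r>0. l = r *\<^sub>R g"
proof -
  have tend: "((\<lambda>t. p + t *\<^sub>R h) \<longlongrightarrow> p) (at_right 0)" for h
    by (auto intro!: tendsto_eq_intros)
  have pos: "l \<bullet> h \<ge> 0" if "g \<bullet> h > 0" for h
  proof -
    have "\<forall>\<^sub>F t in at_right (0::real). t > 0 \<and> f (p + t *\<^sub>R h) > f p \<and>
        (f (p + t *\<^sub>R h) > f p \<longrightarrow> l \<bullet> p \<le> l \<bullet> (p + t *\<^sub>R h))"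
      using eventually_at_right_less[of "0::real"] first_order_increase[OF f that]
        eventually_compose_filterlim[OF l(2) tend[of h]]
      by eventually_elim auto
    then obtain t :: real where "t > 0" "l \<bullet> p \<le> l \<bullet> (p + t *\<^sub>R h)"
      using eventually_happens' trivial_limit_at_right_real by (metis (mono_tags, lifting))
    then show ?thesis
      by (simp add: inner_add_right zero_le_mult_iff)
  qed
  have nonneg: "l \<bullet> h \<ge> 0" if "g \<bullet> h \<ge> 0" for h
  proof (rule field_le_epsilon)
    fix e :: real assume "e > 0"
    \<comment> \<open>Shifting \<open>h\<close> by \<open>\<delta> *\<^sub>R g\<close> moves it into
      the open half-space and changes \<open>l \<bullet> h\<close> by at most \<open>e\<close>; the
      summand 1 avoids division by zero.\<close>
    define \<delta> where "\<delta> = e / (\<bar>l \<bullet> g\<bar> + 1)"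
    have "\<delta> > 0" using \<open>e > 0\<close> by (simp add: \<delta>_def)
    then have "g \<bullet> (h + \<delta> *\<^sub>R g) > 0"
      using that g by (simp add: inner_add_right add_nonneg_pos)
    then have "0 \<le> l \<bullet> h + \<delta> * (l \<bullet> g)"
      using pos by (fastforce simp: inner_add_right)
    moreover have "\<delta> * (l \<bullet> g) \<le> \<delta> * (\<bar>l \<bullet> g\<bar> + 1)"
      using \<open>\<delta> > 0\<close> by (intro mult_left_mono) auto
    moreover have "\<delta> * (\<bar>l \<bullet> g\<bar> + 1) = e"
      by (simp add: \<delta>_def)
    ultimately show "0 \<le> l \<bullet> h + e" by simp
  qed
  define r where "r = (l \<bullet> g) / (g \<bullet> g)"
  \<comment> \<open>\<open>w\<close> is the part of \<open>l\<close> orthogonal to \<open>g\<close>.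
    Both \<open>w\<close> and \<open>- w\<close> lie in the closed half-space, so \<open>l\<close>
    vanishes on \<open>w\<close>, and so \<open>w\<close> is 0.\<close>
  define w where "w = l - r *\<^sub>R g"
  have gw: "g \<bullet> w = 0"
    using g by (simp add: w_def r_def inner_diff_right inner_commute)
  then have "l \<bullet> w = 0"
    using nonneg[of w] nonneg[of "- w"] by simp
  then have "w \<bullet> w = 0"
    using gw by (simp add: w_def inner_diff_left)
  then have lr: "l = r *\<^sub>R g" by (simp add: w_def)
  have "r \<ge> 0" using nonneg[of g] by (simp add: r_def)
  moreover have "r \<noteq> 0" using lr l(1) by auto
  ultimately show ?thesis using lr by (intro exI[of _ r]) simp
qed

lemma local_minimizer_quasi_concave_at:
  fixes f :: "real^'n \<Rightarrow> real"
  assumes f: "real_polynomial_function f"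
    and l: "l \<noteq> 0" "\<forall>\<^sub>F x in nhds p. f x > f p \<longrightarrow> l \<bullet> p \<le> l \<bullet> x"
    and g: "gradient f p \<noteq> 0"
  shows "quasi_concave_at f p"
  unfolding quasi_concave_at_def
proof (intro allI impI, rule ccontr)
  fix v
  let ?g = "gradient f p" and ?q = "v \<bullet> (hessian f p *v v)"
  assume v: "?g \<bullet> v = 0" and "\<not> - ?q \<ge> 0"
  then have q: "?q > 0" by simp
  obtain r where r: "r > 0" "l = r *\<^sub>R ?g"
    using local_minimizer_multiplier[OF real_polynomial_function_gradient_hessian(1)[OF f] l g] by blast
  \<comment> \<open>With this \<open>s\<close> the bending term costs \<open>?q / 2\<close>, half of
    the second-order gain \<open>?q\<close>.\<close>
  define s where "s = ?q / (4 * (?g \<bullet> ?g))"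
  have gg: "?g \<bullet> ?g > 0" using g by simp
  have s: "s > 0" using q gg by (simp add: s_def)
  have "s * (?g \<bullet> ?g) = ?q / 4" using gg by (simp add: s_def)
  then have "?q + 2 * (?g \<bullet> (- s) *\<^sub>R ?g) > 0" using q by simp
  from second_order_increase[OF real_polynomial_function_gradient_hessian(1,2)[OF f] v this]
  have inc: "\<forall>\<^sub>F t in at_right 0. f p < f (p + t *\<^sub>R v + t\<^sup>2 *\<^sub>R (- s) *\<^sub>R ?g)" .
  have tend: "((\<lambda>t. p + t *\<^sub>R v + t\<^sup>2 *\<^sub>R (- s) *\<^sub>R ?g) \<longlongrightarrow> p) (at_right 0)"
    by (auto intro!: tendsto_eq_intros)
  have "\<forall>\<^sub>F t in at_right (0::real). t > 0 \<and> l \<bullet> p \<le> l \<bullet> (p + t *\<^sub>R v + t\<^sup>2 *\<^sub>R (- s) *\<^sub>R ?g)"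
    using eventually_at_right_less[of "0::real"] inc eventually_compose_filterlim[OF l(2) tend]
    by eventually_elim auto
  then obtain t :: real where t: "t > 0" "l \<bullet> p \<le> l \<bullet> (p + t *\<^sub>R v + t\<^sup>2 *\<^sub>R (- s) *\<^sub>R ?g)"
    using eventually_happens' trivial_limit_at_right_real by (metis (mono_tags, lifting))
  \<comment> \<open>As \<open>l\<close> is a multiple of \<open>?g\<close>, the tangent term in
    \<open>v\<close> drops out and only the bending term remains.\<close>
  have "r * (t\<^sup>2 * (s * (?g \<bullet> ?g))) \<le> 0"
    using t(2) v by (simp add: r(2) inner_add_right algebra_simps)
  moreover have "r * (t\<^sup>2 * (s * (?g \<bullet> ?g))) > 0"
    using r(1) t(1) s gg by simp
  ultimately show False by simp
qed

section \<open>Nonsingular boundary points and their limits\<close>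

text \<open>The inactive constraints stay positive near \<open>p\<close>, so nearby points with
  \<open>f i > 0\<close> belong to \<open>T\<close>, where a functional supporting the hull at
  \<open>p\<close> is minimal at \<open>p\<close>.\<close>

lemma nonsingular_boundary_point_quasi_concave_at:
  fixes f :: "nat \<Rightarrow> real^'n \<Rightarrow> real"
  assumes f: "\<And>i. i \<in> {1..m} \<Longrightarrow> real_polynomial_function (f i)"
    and sub: "basic_closed m f \<subseteq> T"
    and i: "i \<in> {1..m}" "f i p = 0"
    and p: "nonsingular_boundary_point m f p" "p \<in> frontier (convex hull T)"
  shows "gradient (f i) p \<noteq> 0" "quasi_concave_at (f i) p"
proof -
  have act: "active_set m f p = {i}"
  proof (rule card_1_singletonE)
    show "card (active_set m f p) = 1"
      using p(1) by (simp add: nonsingular_boundary_point_def)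
    have "i \<in> active_set m f p"
      using i by (simp add: active_set_def)
    then show "active_set m f p = {i}" if "active_set m f p = {j}" for j
      using that by auto
  qed
  then show g: "gradient (f i) p \<noteq> 0"
    using p(1) by (auto simp: nonsingular_boundary_point_def)
  have cont: "isCont (f j) x" if "j \<in> {1..m}" for j x
    using f[OF that] continuous_real_polymonial_function by blast
  have "closed {x. f j x \<ge> 0}" if "j \<in> {1..m}" for j
    using cont[OF that] by (intro closed_Collect_le) (auto intro: continuous_at_imp_continuous_on)
  then have "closed (basic_closed m f)"
    unfolding basic_closed_def Collect_ball_eq by (intro closed_INT) auto
  \<comment> \<open>Closedness puts the frontier point into the set, so each inactive constraint is
    nonnegative and nonzero there, hence positive.\<close>
  then have "p \<in> basic_closed m f"
    using p(1) frontier_subset_closed by (auto simp: nonsingular_boundary_point_def)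
  then have "f j p > 0" if "j \<in> {1..m} - {i}" for j
    using act that by (force simp: basic_closed_def active_set_def)
  then have "\<forall>\<^sub>F x in nhds p. f j x > 0" if "j \<in> {1..m} - {i}" for j
    using that cont[of j p] by (intro order_tendstoD(1)) (auto simp: isCont_def tendsto_at_iff_tendsto_nhds)
  then have "\<forall>\<^sub>F x in nhds p. \<forall>j\<in>{1..m} - {i}. f j x > 0"
    by (intro eventually_ball_finite) auto
  then have loc: "\<forall>\<^sub>F x in nhds p. f i x > f i p \<longrightarrow> x \<in> convex hull T"
  proof eventually_elim
    case (elim x)
    then have "x \<in> basic_closed m f" if "f i x > 0"
      unfolding basic_closed_def mem_Collect_eq
      using elim that by (metis DiffI less_imp_le singletonD)
    then show ?case using sub i(2) hull_subset[of T convex] by auto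
  qed
  obtain l where l: "l \<noteq> 0" "\<And>y. y \<in> convex hull T \<Longrightarrow> l \<bullet> p \<le> l \<bullet> y"
    using supporting_hyperplane_frontier[OF convex_convex_hull p(2)] by blast
  from loc have "\<forall>\<^sub>F x in nhds p. f i x > f i p \<longrightarrow> l \<bullet> p \<le> l \<bullet> x"
    by eventually_elim (use l in auto)
  then show "quasi_concave_at (f i) p"
    using local_minimizer_quasi_concave_at[OF f[OF i(1)] l(1) _ g] by blast
qed

text \<open>The tangent space varies with the point, so a tangent vector at \<open>u\<close> must
  first be approximated by tangent vectors at the points \<open>U N\<close>.\<close>

lemma quasi_concave_at_sequential_limit:
  fixes f :: "real^'n \<Rightarrow> real"
  assumes f: "real_polynomial_function f"
    and U: "U \<longlonglongrightarrow> u" "\<And>N. gradient f (U N) \<noteq> 0" "\<And>N. quasi_concave_at f (U N)"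
    and u: "gradient f u \<noteq> 0"
  shows "quasi_concave_at f u"
  unfolding quasi_concave_at_def
proof (intro allI impI)
  fix v assume v: "gradient f u \<bullet> v = 0"
  \<comment> \<open>\<open>V x\<close> is the orthogonal projection of \<open>v\<close> to the
    tangent space at \<open>x\<close>. It tends to \<open>v\<close> along the sequence because
    \<open>v\<close> is tangent at \<open>u\<close> and the denominator has a nonzero limit.\<close>
  define V where "V x = v - ((gradient f x \<bullet> v) / (gradient f x \<bullet> gradient f x)) *\<^sub>R gradient f x" for x
  have G: "(\<lambda>N. gradient f (U N)) \<longlonglongrightarrow> gradient f u"
    and H: "(\<lambda>N. hessian f (U N)) \<longlonglongrightarrow> hessian f u"
    using real_polynomial_function_gradient_hessian(3,4)[OF f] U(1)
    by (auto intro: continuous_on_tendsto_compose)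
  have V: "(\<lambda>N. V (U N)) \<longlonglongrightarrow> v"
    unfolding V_def using u v by (auto intro!: tendsto_eq_intros G)
  have "gradient f (U N) \<bullet> V (U N) = 0" for N
    using U(2)[of N] by (simp add: V_def inner_diff_right)
  then have "- (V (U N) \<bullet> (hessian f (U N) *v V (U N))) \<ge> 0" for N
    using U(3)[of N] unfolding quasi_concave_at_def by blast
  moreover have "(\<lambda>N. - (V (U N) \<bullet> (hessian f (U N) *v V (U N)))) \<longlonglongrightarrow> - (v \<bullet> (hessian f u *v v))"
    unfolding matrix_vector_mult_def by (intro tendsto_intros V H)
  ultimately show "- (v \<bullet> (hessian f u *v v)) \<ge> 0"
    by (meson LIMSEQ_le_const)
qed

theorem theorem4p6:
  fixes T :: "(real^'n) set"
    and L :: nat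
    and m :: "nat \<Rightarrow> nat"
    and f :: "nat \<Rightarrow> nat \<Rightarrow> real^'n \<Rightarrow> real"
  assumes "\<And>k i. k \<in> {1..L} \<Longrightarrow> i \<in> {1..m k} \<Longrightarrow> real_polynomial_function (f k i)"
    and "T = (\<Union>k\<in>{1..L}. basic_closed (m k) (f k))"
    and "compact T"
    and "sdp_representable (convex hull T)"
  shows "\<forall>k\<in>{1..L}. \<forall>u \<in> convex_boundary T \<inter> frontier (basic_closed (m k) (f k)).
           \<forall>i \<in> active_set (m k) (f k) u.
             nonsingular_at (f k i) u \<and> irredundant_at T (m k) (f k) i u \<longrightarrow>
             quasi_concave_at (f k i) u"
proof (intro ballI impI, elim conjE)
  fix k u i
  assume k: "k \<in> {1..L}" and "i \<in> active_set (m k) (f k) u"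
    and ns: "nonsingular_at (f k i) u" and "irredundant_at T (m k) (f k) i u"
  then obtain U where i: "i \<in> {1..m k}" and U: "U \<longlonglongrightarrow> u"
    "\<And>N. nonsingular_boundary_point (m k) (f k) (U N)"
    "\<And>N. f k i (U N) = 0" "\<And>N. U N \<in> frontier (convex hull T)"
    by (auto simp: active_set_def irredundant_at_def)
  have "basic_closed (m k) (f k) \<subseteq> T"
    using assms(2) k by blast
  \<comment> \<open>Each point of the sequence given by irredundancy is nonsingular and on the
    boundary of the hull, so quasi-concavity holds along the sequence and passes to
    \<open>u\<close>.\<close>
  note nbp = nonsingular_boundary_point_quasi_concave_at[OF assms(1)[OF k] this i U(3) U(2) U(4)]
  show "quasi_concave_at (f k i) u"
    using quasi_concave_at_sequential_limit[OF assms(1)[OF k i] U(1) nbp] ns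
    by (simp add: nonsingular_at_def)
qed

end
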